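(* Consider the private and complete information models for $\sigma$-correlated preferences, and for $\Gamma\in\{S,U,W\}$ let $W^\Gamma$ be the welfare when all $N$ consumers use the equilibrium consumption of behavior model $\Gamma$. For large $N$ and $\bar g$, the following relations hold in both information models: 1. The ratio of expected welfare when consumers act selfishly versus as welfare maximizers is $$\frac{E[W^S]}{E[W^W]}=\frac{4\alpha^2+4\alpha\gamma+4\kappa(\gamma-\kappa)}{4\alpha^2+4\alpha\gamma+\gamma^2}.$$ That is, welfare-maximizing behavior achieves a strictly higher welfare, except when they are equal at $\gamma=2\kappa$. 2. The ratio of expected welfare when consumers act altruistically versus as welfare maximizers is $$\frac{E[W^U]}{E[W^W]}=\frac{(\kappa+\alpha)(2\gamma+\alpha-\kappa)}{(\gamma+\alpha)^2},$$ which is strictly less than $1$ for any parameter value, except when the welfares are equal at $\gamma=\kappa$.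
   Context: There are $N$ consumers. Constants $\gamma,\alpha,\kappa>0$, $\bar g>0$, $\sigma\in[0,1]$. The preference vector $(g_1,\dots,g_N)$ is normal with mean $\bar g\mathbf{1}$ and is $\sigma$-correlated: covariance matrix with diagonal entries $1$ and off-diagonal entries $\sigma$. $\omega$ is a real random variable with mean $\bar\omega$, independent of the preferences. When consumer $i$ consumes $s_i$ and $L=\sum_is_i$, the price is $p=\frac{\gamma}{N}(L+\omega)$, the aggregate utility is $U=\sum_{i=1}^N(-s_ip+g_is_i-\alpha s_i^2)$, the operator's net revenue is $NR=pL-\frac{\kappa}{N}L^2$, and the welfare is $W=U+NR$. Put $\lambda^S=\mu^S=\tau^S=\gamma/N$; $\lambda^U=2\gamma/N$, $\mu^U=\tau^U=\gamma/N$; $\lambda^W=2\kappa/N$, $\mu^W=0$, $\tau^W=\kappa/N$; $\rho^\Gamma=(2(\tau^\Gamma+\alpha))^{-1}$; $b^\Gamma=\rho^\Gamma(1+\lambda^\Gamma\rho^\Gamma(N-1))^{-1}$. The behavior models are: $S$ (selfish), $U$ (altruistic), $W$ (welfare-maximizing). The Bayesian Nash equilibrium consumptions are as follows. Private information (consumer $i$ knows only $g_i$): $s_i^\Gamma=a^\Gamma(g_i-\bar g)+b^\Gamma(\bar g-\bar\omega\mu^\Gamma)$ with $a^\Gamma=\rho^\Gamma(1+\lambda^\Gamma\rho^\Gamma\sigma(N-1))^{-1}$. Complete information (consumer $i$ knows $g_i$ and $\sum_jg_j$): $s_i^\Gamma=a^\Gamma(g_i-\frac1N\sum_jg_j)+b^\Gamma(\frac1N\sum_jg_j-\bar\omega\mu^\Gamma)$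 with $a^\Gamma=\rho^\Gamma(1-\lambda^\Gamma\rho^\Gamma)^{-1}$. The relations "for large $N$ and $\bar g$" are obtained from the expression of $E[W]/N$ for $\bar\omega=0$ by keeping only the terms multiplying $\bar g^2$, namely $(b^\Gamma-(\kappa+\alpha)(b^\Gamma)^2)\bar g^2$, with the large-$N$ approximations $b^S\approx(\gamma+2\alpha)^{-1}$, $b^U\approx(2(\gamma+\alpha))^{-1}$, $b^W\approx(2(\kappa+\alpha))^{-1}$. *)

theory Defs
  imports "HOL-Probability.Probability"
begin

datatype behavior = Selfish | Altruistic | Welfare_Maximizing

datatype information = Private | Complete

fun lam :: "real \<Rightarrow> real \<Rightarrow> nat \<Rightarrow> behavior \<Rightarrow> real" where
  "lam \<gamma> \<kappa> N Selfish = \<gamma> / real N"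
| "lam \<gamma> \<kappa> N Altruistic = 2 * \<gamma> / real N"
| "lam \<gamma> \<kappa> N Welfare_Maximizing = 2 * \<kappa> / real N"

fun mu :: "real \<Rightarrow> nat \<Rightarrow> behavior \<Rightarrow> real" where
  "mu \<gamma> N Selfish = \<gamma> / real N"
| "mu \<gamma> N Altruistic = \<gamma> / real N"
| "mu \<gamma> N Welfare_Maximizing = 0"

fun tau :: "real \<Rightarrow> real \<Rightarrow> nat \<Rightarrow> behavior \<Rightarrow> real" where
  "tau \<gamma> \<kappa> N Selfish = \<gamma> / real N"
| "tau \<gamma> \<kappa> N Altruistic = \<gamma> / real N"
| "tau \<gamma> \<kappa> N Welfare_Maximizing = \<kappa> / real N"

definition rho :: "real \<Rightarrow> real \<Rightarrow> real \<Rightarrow> nat \<Rightarrow> behavior \<Rightarrow> real" where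
  "rho \<gamma> \<alpha> \<kappa> N \<Gamma> = inverse (2 * (tau \<gamma> \<kappa> N \<Gamma> + \<alpha>))"

definition coeff_b :: "real \<Rightarrow> real \<Rightarrow> real \<Rightarrow> nat \<Rightarrow> behavior \<Rightarrow> real" where
  "coeff_b \<gamma> \<alpha> \<kappa> N \<Gamma> =
     rho \<gamma> \<alpha> \<kappa> N \<Gamma> * inverse (1 + lam \<gamma> \<kappa> N \<Gamma> * rho \<gamma> \<alpha> \<kappa> N \<Gamma> * (real N - 1))"

fun coeff_a :: "information \<Rightarrow> real \<Rightarrow> real \<Rightarrow> real \<Rightarrow> real \<Rightarrow> nat \<Rightarrow> behavior \<Rightarrow> real" where
  "coeff_a Private \<gamma> \<alpha> \<kappa> \<sigma> N \<Gamma> =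
     rho \<gamma> \<alpha> \<kappa> N \<Gamma> * inverse (1 + lam \<gamma> \<kappa> N \<Gamma> * rho \<gamma> \<alpha> \<kappa> N \<Gamma> * \<sigma> * (real N - 1))"
| "coeff_a Complete \<gamma> \<alpha> \<kappa> \<sigma> N \<Gamma> =
     rho \<gamma> \<alpha> \<kappa> N \<Gamma> * inverse (1 - lam \<gamma> \<kappa> N \<Gamma> * rho \<gamma> \<alpha> \<kappa> N \<Gamma>)"

text \<open>Consumers are numbered \<open>1, \<dots>, N\<close>; \<open>g\<close> is a realized preference vector, so the
  following is the closed form of the Bayesian Nash equilibrium strategy of consumer \<open>i\<close>,
  evaluated at \<open>g\<close>.\<close>

fun equilibrium_consumption ::
  "information \<Rightarrow> real \<Rightarrow> real \<Rightarrow> real \<Rightarrow> real \<Rightarrow> nat \<Rightarrow> real \<Rightarrow> real \<Rightarrow> behavior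
    \<Rightarrow> (nat \<Rightarrow> real) \<Rightarrow> nat \<Rightarrow> real" where
  "equilibrium_consumption Private \<gamma> \<alpha> \<kappa> \<sigma> N gbar \<omega>bar \<Gamma> g i =
     coeff_a Private \<gamma> \<alpha> \<kappa> \<sigma> N \<Gamma> * (g i - gbar)
     + coeff_b \<gamma> \<alpha> \<kappa> N \<Gamma> * (gbar - \<omega>bar * mu \<gamma> N \<Gamma>)"
| "equilibrium_consumption Complete \<gamma> \<alpha> \<kappa> \<sigma> N gbar \<omega>bar \<Gamma> g i =
     coeff_a Complete \<gamma> \<alpha> \<kappa> \<sigma> N \<Gamma> * (g i - (\<Sum>j=1..N. g j) / real N)
     + coeff_b \<gamma> \<alpha> \<kappa> N \<Gamma> * ((\<Sum>j=1..N. g j) / real N - \<omega>bar * mu \<gamma> N \<Gamma>)"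

definition price :: "real \<Rightarrow> nat \<Rightarrow> real \<Rightarrow> (nat \<Rightarrow> real) \<Rightarrow> real" where
  "price \<gamma> N w s = \<gamma> / real N * ((\<Sum>i=1..N. s i) + w)"

definition aggregate_utility ::
  "real \<Rightarrow> real \<Rightarrow> nat \<Rightarrow> real \<Rightarrow> (nat \<Rightarrow> real) \<Rightarrow> (nat \<Rightarrow> real) \<Rightarrow> real" where
  "aggregate_utility \<gamma> \<alpha> N w g s =
     (\<Sum>i=1..N. - s i * price \<gamma> N w s + g i * s i - \<alpha> * (s i)\<^sup>2)"

definition net_revenue :: "real \<Rightarrow> real \<Rightarrow> nat \<Rightarrow> real \<Rightarrow> (nat \<Rightarrow> real) \<Rightarrow> real" where
  "net_revenue \<gamma> \<kappa> N w s =
     price \<gamma> N w s * (\<Sum>i=1..N. s i) - \<kappa> / real N * (\<Sum>i=1..N. s i)\<^sup>2"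

definition welfare ::
  "real \<Rightarrow> real \<Rightarrow> real \<Rightarrow> nat \<Rightarrow> real \<Rightarrow> (nat \<Rightarrow> real) \<Rightarrow> (nat \<Rightarrow> real) \<Rightarrow> real" where
  "welfare \<gamma> \<alpha> \<kappa> N w g s = aggregate_utility \<gamma> \<alpha> N w g s + net_revenue \<gamma> \<kappa> N w s"

definition expected_welfare ::
  "'a measure \<Rightarrow> (nat \<Rightarrow> 'a \<Rightarrow> real) \<Rightarrow> ('a \<Rightarrow> real) \<Rightarrow> information \<Rightarrow> real \<Rightarrow> real \<Rightarrow> real
    \<Rightarrow> real \<Rightarrow> nat \<Rightarrow> real \<Rightarrow> real \<Rightarrow> behavior \<Rightarrow> real" where
  "expected_welfare M g \<omega> info \<gamma> \<alpha> \<kappa> \<sigma> N gbar \<omega>bar \<Gamma> =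
     prob_space.expectation M (\<lambda>x. welfare \<gamma> \<alpha> \<kappa> N (\<omega> x) (\<lambda>i. g i x)
       (equilibrium_consumption info \<gamma> \<alpha> \<kappa> \<sigma> N gbar \<omega>bar \<Gamma> (\<lambda>i. g i x)))"

text \<open>Normal laws are allowed to be degenerate, since the covariance matrix below is singular
  for \<open>\<sigma> = 1\<close>. The variance is \<open>v\<close>; \<open>normal_density\<close> takes the standard deviation.\<close>

definition normal_law :: "real \<Rightarrow> real \<Rightarrow> real measure" where
  "normal_law m v =
     (if v = 0 then return borel m else density lborel (normal_density m (sqrt v)))"

text \<open>A random vector is normal if all linear combinations of its components are normal.\<close>

definition jointly_normal :: "'a measure \<Rightarrow> 'i set \<Rightarrow> ('i \<Rightarrow> 'a \<Rightarrow> real) \<Rightarrow> bool" where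
  "jointly_normal M I X \<longleftrightarrow>
     (\<forall>i\<in>I. X i \<in> borel_measurable M) \<and>
     (\<forall>t. \<exists>m v. 0 \<le> v \<and> distr M borel (\<lambda>x. \<Sum>i\<in>I. t i * X i x) = normal_law m v)"

definition covariance :: "'a measure \<Rightarrow> ('a \<Rightarrow> real) \<Rightarrow> ('a \<Rightarrow> real) \<Rightarrow> real" where
  "covariance M X Y = prob_space.expectation M
     (\<lambda>x. (X x - prob_space.expectation M X) * (Y x - prob_space.expectation M Y))"

definition correlated_preferences ::
  "'a measure \<Rightarrow> (nat \<Rightarrow> 'a \<Rightarrow> real) \<Rightarrow> nat \<Rightarrow> real \<Rightarrow> real \<Rightarrow> bool" where
  "correlated_preferences M g N gbar \<sigma> \<longleftrightarrow>
     jointly_normal M {1..N} g \<and>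
     (\<forall>i\<in>{1..N}. prob_space.expectation M (g i) = gbar) \<and>
     (\<forall>i\<in>{1..N}. \<forall>j\<in>{1..N}. covariance M (g i) (g j) = (if i = j then 1 else \<sigma>))"

text \<open>\<open>indep_var\<close> requires both random variables to have the same type, so the independence of
  \<open>\<omega>\<close> from the whole preference vector is stated for the generated sigma-algebras.\<close>

definition consumer_model ::
  "'a measure \<Rightarrow> (nat \<Rightarrow> 'a \<Rightarrow> real) \<Rightarrow> ('a \<Rightarrow> real) \<Rightarrow> nat \<Rightarrow> real \<Rightarrow> real \<Rightarrow> real \<Rightarrow> bool" where
  "consumer_model M g \<omega> N gbar \<omega>bar \<sigma> \<longleftrightarrow>
     prob_space M \<and>
     correlated_preferences M g N gbar \<sigma> \<and>
     integrable M \<omega> \<and> prob_space.expectation M \<omega> = \<omega>bar \<and>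
     prob_space.indep_set M
       {\<omega> -` A \<inter> space M | A. A \<in> sets borel}
       {(\<lambda>x. \<lambda>i\<in>{1..N}. g i x) -` B \<inter> space M | B. B \<in> sets (Pi\<^sub>M {1..N} (\<lambda>_. borel))}"

text \<open>The large-\<open>N\<close> approximations of \<open>coeff_b\<close>, and the resulting coefficient of \<open>gbar\<^sup>2\<close> in
  the expected welfare per consumer.\<close>

fun large_b :: "real \<Rightarrow> real \<Rightarrow> real \<Rightarrow> behavior \<Rightarrow> real" where
  "large_b \<gamma> \<alpha> \<kappa> Selfish = inverse (\<gamma> + 2 * \<alpha>)"
| "large_b \<gamma> \<alpha> \<kappa> Altruistic = inverse (2 * (\<gamma> + \<alpha>))"
| "large_b \<gamma> \<alpha> \<kappa> Welfare_Maximizing = inverse (2 * (\<kappa> + \<alpha>))"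

definition leading_welfare :: "real \<Rightarrow> real \<Rightarrow> real \<Rightarrow> behavior \<Rightarrow> real" where
  "leading_welfare \<gamma> \<alpha> \<kappa> \<Gamma> =
     large_b \<gamma> \<alpha> \<kappa> \<Gamma> - (\<kappa> + \<alpha>) * (large_b \<gamma> \<alpha> \<kappa> \<Gamma>)\<^sup>2"

end

theory Submission
  imports Defs
begin

text \<open>In the welfare the payments \<open>p L\<close> of the consumers cancel against the revenue of the
  operator, so \<open>\<omega>\<close> drops out and only the first two moments of the preferences matter. In both
  information models the equilibrium is affine in the preferences, with the same constant part
  \<open>b (gbar - \<omega>bar \<mu>)\<close>; hence \<open>E[W] / N\<close> is a bounded variance term plus
  \<open>b gbar\<^sup>2 - (\<kappa> + \<alpha>) b\<^sup>2 gbar\<^sup>2\<close> up to terms of order \<open>gbar\<close>.\<close>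

section \<open>Second moments of jointly normal preferences\<close>

text \<open>A point mass is handled by boundedness. Otherwise the square about an arbitrary center
  \<open>c\<close> reduces to moments about the mean, all of which are finite for a normal
  density.\<close>

lemma integrable_power2_normal_law:
  assumes "0 \<le> v"
  shows "integrable (normal_law m v) (\<lambda>x. (x - c)\<^sup>2)"
proof (cases "v = 0")
  case True
  interpret prob_space "return borel m"
    by (rule prob_space_return) simp
  have "integrable (return borel m) (\<lambda>x::real. (x - c)\<^sup>2)"
    by (rule integrable_const_bound[where B = "(m - c)\<^sup>2"]) (auto simp: AE_return)
  then show ?thesis
    using True by (simp add: normal_law_def)
next
  case False
  define s where "s = sqrt v"
  have s: "s > 0"
    using False assms by (simp add: s_def)
  \<comment> \<open>Expansion of \<open>x - c = (x - m) + (m - c)\<close>; the exponents 1 and 0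
    stay visible so that each summand is a central moment.\<close>
  have eq: "normal_density m s x * (x - c)\<^sup>2 =
      normal_density m s x * (x - m) ^ 2 + (2 * (m - c)) * (normal_density m s x * (x - m) ^ 1)
      + (m - c)\<^sup>2 * (normal_density m s x * (x - m) ^ 0)" for x
    by (simp add: power2_eq_square algebra_simps)
  have "integrable lborel (\<lambda>x. normal_density m s x * (x - c)\<^sup>2)"
    unfolding eq
    by (intro Bochner_Integration.integrable_add integrable_mult_right integrable_normal_moment s)
  then have "integrable (density lborel (normal_density m s)) (\<lambda>x. (x - c)\<^sup>2)"
    by (subst integrable_density) auto
  then show ?thesis
    using False by (simp add: normal_law_def s_def)
qed

text \<open>Taking the indicator of \<open>i\<close> as coefficient vector in the definition of
  joint normality shows that the single component \<open>X i\<close> has a normal law. The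
  integrability then transfers from that law to \<open>M\<close>.\<close>

lemma jointly_normal_integrable_power2:
  assumes "jointly_normal M I X" and "finite I" and "i \<in> I"
  shows "integrable M (\<lambda>x. (X i x - c)\<^sup>2)"
proof -
  have X [measurable]: "X i \<in> borel_measurable M"
    using assms by (auto simp: jointly_normal_def)
  obtain m v where v: "0 \<le> v"
    and "distr M borel (\<lambda>x. \<Sum>j\<in>I. (if j = i then 1 else 0) * X j x) = normal_law m v"
    using assms(1) unfolding jointly_normal_def by meson
  moreover have "(\<lambda>x. \<Sum>j\<in>I. (if j = i then 1 else 0) * X j x) = X i"
    using assms(2,3) by (simp add: if_distrib[of "\<lambda>a. a * _"] sum.delta cong: if_cong)
  ultimately have "distr M borel (X i) = normal_law m v"
    by simp
  then have "integrable (distr M borel (X i)) (\<lambda>y. (y - c)\<^sup>2)"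
    using integrable_power2_normal_law[OF v] by simp
  then show ?thesis
    by (subst (asm) integrable_distr_eq) auto
qed

text \<open>The product is dominated by the sum of the squares. This makes the products behind the
  covariances integrable, so expectations of double sums may be split.\<close>

lemma integrable_mult_of_power2:
  fixes X Y :: "'a \<Rightarrow> real"
  assumes [measurable]: "X \<in> borel_measurable M" "Y \<in> borel_measurable M"
    and "integrable M (\<lambda>x. (X x)\<^sup>2)" and "integrable M (\<lambda>x. (Y x)\<^sup>2)"
  shows "integrable M (\<lambda>x. X x * Y x)"
proof (rule Bochner_Integration.integrable_bound)
  show "integrable M (\<lambda>x. (X x)\<^sup>2 + (Y x)\<^sup>2)"
    using assms by simp
  have "\<bar>X x * Y x\<bar> \<le> (X x)\<^sup>2 + (Y x)\<^sup>2" for x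
  proof -
    have "0 \<le> (\<bar>X x\<bar> - \<bar>Y x\<bar>)\<^sup>2" by simp
    then have "2 * (\<bar>X x\<bar> * \<bar>Y x\<bar>) \<le> (X x)\<^sup>2 + (Y x)\<^sup>2"
      by (simp add: power2_diff)
    moreover have "0 \<le> \<bar>X x\<bar> * \<bar>Y x\<bar>" by simp
    ultimately show ?thesis unfolding abs_mult by linarith
  qed
  then show "AE x in M. norm (X x * Y x) \<le> norm ((X x)\<^sup>2 + (Y x)\<^sup>2)"
    by auto
qed measurable

section \<open>Exact expected welfare of affine strategies\<close>

text \<open>The strategy has one weight for the own deviation, one for the average deviation and a
  constant, which covers both information models. The right-hand side isolates the three random
  quantities whose expectations follow from means and covariances; squares are written as products
  to match the covariances.\<close>

lemma welfare_affine_consumption: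
  fixes g :: "nat \<Rightarrow> real"
  assumes "N \<ge> 1"
    and s: "\<And>i. s i = a * (g i - gbar) + c * ((\<Sum>j=1..N. g j - gbar) / real N) + d"
  shows "welfare \<gamma> \<alpha> \<kappa> N w g s =
      (a - \<alpha> * a\<^sup>2) * (\<Sum>i=1..N. (g i - gbar) * (g i - gbar))
      + (c - \<alpha> * c\<^sup>2 - 2 * \<alpha> * a * c - \<kappa> * (a + c)\<^sup>2) / real N
          * (\<Sum>i=1..N. \<Sum>j=1..N. (g i - gbar) * (g j - gbar))
      + (d + gbar * (a + c) - 2 * (\<alpha> + \<kappa>) * d * (a + c)) * (\<Sum>i=1..N. g i - gbar)
      + real N * (gbar * d - (\<alpha> + \<kappa>) * d\<^sup>2)"
proof -
  define G where "G i = g i - gbar" for i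
  define S where "S = (\<Sum>i=1..N. G i)"
  define Q where "Q = (\<Sum>i=1..N. G i * G i)"
  define A where "A = S / real N"
  have N: "real N > 0" using assms by simp
  have SA: "S = real N * A" using N by (simp add: A_def)
  have sG: "s i = a * G i + c * A + d" for i
    by (simp add: s G_def S_def A_def)
  have L: "(\<Sum>i=1..N. s i) = a * S + real N * (c * A + d)"
    by (simp add: sG S_def sum.distrib sum_distrib_left algebra_simps)
  \<comment> \<open>The payments sum to the price times total consumption and cancel against the
    revenue, which removes \<open>w\<close>.\<close>
  have "welfare \<gamma> \<alpha> \<kappa> N w g s =
      (\<Sum>i=1..N. g i * s i - \<alpha> * (s i)\<^sup>2) - \<kappa> / real N * (\<Sum>i=1..N. s i)\<^sup>2"
    unfolding welfare_def aggregate_utility_def net_revenue_def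
    by (simp add: sum.distrib sum_subtractf sum_negf flip: sum_distrib_right)
  \<comment> \<open>Each summand is a quadratic polynomial in \<open>G i\<close>, since
    \<open>c * A + d\<close> does not depend on \<open>i\<close>.\<close>
  also have "(\<Sum>i=1..N. g i * s i - \<alpha> * (s i)\<^sup>2) =
      (\<Sum>i=1..N. (a - \<alpha> * a\<^sup>2) * (G i * G i)
        + (c * A + d + a * gbar - 2 * \<alpha> * a * (c * A + d)) * G i
        + (gbar * (c * A + d) - \<alpha> * (c * A + d)\<^sup>2))"
    by (intro sum.cong refl) (simp add: sG, simp add: G_def power2_eq_square algebra_simps)
  also have "\<dots> = (a - \<alpha> * a\<^sup>2) * Q
        + (c * A + d + a * gbar - 2 * \<alpha> * a * (c * A + d)) * S
        + real N * (gbar * (c * A + d) - \<alpha> * (c * A + d)\<^sup>2)"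
    by (simp add: sum.distrib Q_def S_def flip: sum_distrib_left)
  finally have W: "welfare \<gamma> \<alpha> \<kappa> N w g s = (a - \<alpha> * a\<^sup>2) * Q
        + (c * A + d + a * gbar - 2 * \<alpha> * a * (c * A + d)) * S
        + real N * (gbar * (c * A + d) - \<alpha> * (c * A + d)\<^sup>2)
        - \<kappa> / real N * (a * S + real N * (c * A + d))\<^sup>2"
    by (simp only: L)
  have "(\<Sum>i=1..N. \<Sum>j=1..N. G i * G j) = S * S"
    by (simp add: S_def sum_product)
  then show ?thesis
    unfolding W G_def[symmetric] Q_def[symmetric] S_def[symmetric] using N
    by (simp add: SA field_simps power2_eq_square)
qed

text \<open>The linear term has expectation 0, the squares contribute the unit variances, and the
  double sum contributes the square of \<open>N\<close> times
  \<open>\<sigma> + (1 - \<sigma>) / real N\<close>, the variance of the average preference.\<close>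

lemma expectation_welfare_affine_consumption:
  assumes "prob_space M" and corr: "correlated_preferences M g N gbar \<sigma>" and "N \<ge> 1"
    and s: "\<And>x i. s x i = a * (g i x - gbar) + c * ((\<Sum>j=1..N. g j x - gbar) / real N) + d"
  shows "prob_space.expectation M (\<lambda>x. welfare \<gamma> \<alpha> \<kappa> N (w x) (\<lambda>i. g i x) (s x)) =
      real N * (a - \<alpha> * a\<^sup>2
        + (c - \<alpha> * c\<^sup>2 - 2 * \<alpha> * a * c - \<kappa> * (a + c)\<^sup>2) * (\<sigma> + (1 - \<sigma>) / real N)
        + gbar * d - (\<alpha> + \<kappa>) * d\<^sup>2)"
proof -
  interpret prob_space M by fact
  define G where "G i x = g i x - gbar" for i x
  define v where "v = \<sigma> + (1 - \<sigma>) / real N"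
  have normal: "jointly_normal M {1..N} g"
    and mean: "\<And>i. i \<in> {1..N} \<Longrightarrow> expectation (g i) = gbar"
    and cov: "\<And>i j. i \<in> {1..N} \<Longrightarrow> j \<in> {1..N} \<Longrightarrow>
      covariance M (g i) (g j) = (if i = j then 1 else \<sigma>)"
    using corr by (auto simp: correlated_preferences_def)
  have g_meas: "g i \<in> borel_measurable M" if "i \<in> {1..N}" for i
    using normal that by (auto simp: jointly_normal_def)
  have G_meas: "G i \<in> borel_measurable M" if "i \<in> {1..N}" for i
    using g_meas[OF that] unfolding G_def[abs_def] by measurable
  have G2: "integrable M (\<lambda>x. (G i x)\<^sup>2)" if "i \<in> {1..N}" for i
    using jointly_normal_integrable_power2[OF normal _ that] by (simp add: G_def)
  have GG: "integrable M (\<lambda>x. G i x * G j x)" if "i \<in> {1..N}" "j \<in> {1..N}" for i j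
    by (intro integrable_mult_of_power2 G_meas G2 that)
  have G1: "integrable M (G i)" if "i \<in> {1..N}" for i
    using square_integrable_imp_integrable[OF G_meas[OF that] G2[OF that]] .
  have EG: "expectation (G i) = 0" if i: "i \<in> {1..N}" for i
  proof -
    \<comment> \<open>Integrability of \<open>g i\<close> is recovered from \<open>G i\<close>,
      because a value of the expectation does not imply it: integrals of nonintegrable functions are
      0 by convention.\<close>
    have "integrable M (\<lambda>x. G i x + gbar)"
      using G1[OF i] by simp
    then have "integrable M (g i)" by (simp add: G_def)
    then show ?thesis
      using mean[OF i] by (simp add: G_def[abs_def] prob_space)
  qed
  have EGG: "expectation (\<lambda>x. G i x * G j x) = (if i = j then 1 else \<sigma>)"
    if "i \<in> {1..N}" "j \<in> {1..N}" for i j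
    using cov[OF that] mean[OF that(1)] mean[OF that(2)] by (simp add: covariance_def G_def)
  have Q: "integrable M (\<lambda>x. \<Sum>i=1..N. G i x * G i x)"
    "expectation (\<lambda>x. \<Sum>i=1..N. G i x * G i x) = real N"
    using GG EGG by (auto simp: Bochner_Integration.integral_sum)
  have S: "integrable M (\<lambda>x. \<Sum>i=1..N. G i x)" "expectation (\<lambda>x. \<Sum>i=1..N. G i x) = 0"
    using G1 EG by (auto simp: Bochner_Integration.integral_sum)
  have D: "integrable M (\<lambda>x. \<Sum>i=1..N. \<Sum>j=1..N. G i x * G j x)"
    using GG by (auto intro!: Bochner_Integration.integrable_sum)
  have "expectation (\<lambda>x. \<Sum>i=1..N. \<Sum>j=1..N. G i x * G j x)
      = (\<Sum>i=1..N. expectation (\<lambda>x. \<Sum>j=1..N. G i x * G j x))"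
    using GG by (intro Bochner_Integration.integral_sum Bochner_Integration.integrable_sum)
  also have "\<dots> = (\<Sum>i=1..N. \<Sum>j=1..N. expectation (\<lambda>x. G i x * G j x))"
    using GG by (intro sum.cong refl Bochner_Integration.integral_sum)
  \<comment> \<open>The covariance matrix is split into the constant \<open>\<sigma>\<close> and a
    diagonal correction \<open>1 - \<sigma>\<close>.\<close>
  also have "\<dots> = (\<Sum>i=1..N. \<Sum>j=1..N. \<sigma> + (if i = j then 1 - \<sigma> else 0))"
    by (intro sum.cong refl) (simp add: EGG)
  also have "\<dots> = real N * (real N * \<sigma> + (1 - \<sigma>))"
    by (simp add: sum.distrib algebra_simps)
  also have "real N * \<sigma> + (1 - \<sigma>) = real N * v"
    using \<open>N \<ge> 1\<close> by (simp add: v_def field_simps)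
  finally have ED: "expectation (\<lambda>x. \<Sum>i=1..N. \<Sum>j=1..N. G i x * G j x) =
      real N * (real N * v)" .
  \<comment> \<open>Stated for arbitrary coefficients so that it rewrites the decomposed welfare
    directly; the term with \<open>t\<close> has mean 0.\<close>
  have lin: "expectation (\<lambda>x. p * (\<Sum>i=1..N. G i x * G i x)
      + q * (\<Sum>i=1..N. \<Sum>j=1..N. G i x * G j x) + t * (\<Sum>i=1..N. G i x) + k)
    = p * real N + q * (real N * (real N * v)) + k" for p q t k
    using Q S D ED by (simp add: prob_space)
  have cancel: "q / real N * (real N * (real N * v)) = real N * (q * v)" for q
    using \<open>N \<ge> 1\<close> by simp
  show ?thesis
    unfolding welfare_affine_consumption[OF \<open>N \<ge> 1\<close> s] G_def[symmetric] lin v_def[symmetric] cancel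
    by (simp add: algebra_simps)
qed

text \<open>Private information puts no weight on the average. Under complete information, centering
  both occurrences of the average at \<open>gbar\<close> leaves it the weight \<open>b - a\<close>.
  The constant part \<open>d\<close> is the same in both models.\<close>

lemma expected_welfare_eq:
  assumes "consumer_model M g \<omega> N gbar \<omega>bar \<sigma>" and "N \<ge> 1"
    and "a = coeff_a info \<gamma> \<alpha> \<kappa> \<sigma> N \<Gamma>" and "b = coeff_b \<gamma> \<alpha> \<kappa> N \<Gamma>"
    and "c = (case info of Private \<Rightarrow> 0 | Complete \<Rightarrow> b - a)"
    and "d = b * (gbar - \<omega>bar * mu \<gamma> N \<Gamma>)"
  shows "expected_welfare M g \<omega> info \<gamma> \<alpha> \<kappa> \<sigma> N gbar \<omega>bar \<Gamma> =
      real N * (a - \<alpha> * a\<^sup>2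
        + (c - \<alpha> * c\<^sup>2 - 2 * \<alpha> * a * c - \<kappa> * (a + c)\<^sup>2) * (\<sigma> + (1 - \<sigma>) / real N)
        + gbar * d - (\<alpha> + \<kappa>) * d\<^sup>2)"
  unfolding expected_welfare_def
proof (rule expectation_welfare_affine_consumption)
  show "prob_space M" "correlated_preferences M g N gbar \<sigma>" "N \<ge> 1"
    using assms(1,2) by (auto simp: consumer_model_def)
  show "equilibrium_consumption info \<gamma> \<alpha> \<kappa> \<sigma> N gbar \<omega>bar \<Gamma> (\<lambda>i. g i x) i =
      a * (g i x - gbar) + c * ((\<Sum>j=1..N. g j x - gbar) / real N) + d" for x i
  proof -
    define m where "m = (\<Sum>j=1..N. g j x) / real N"
    have "(\<Sum>j=1..N. g j x - gbar) / real N = m - gbar"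
      using \<open>N \<ge> 1\<close> by (simp add: m_def sum_subtractf field_simps)
    moreover have "equilibrium_consumption info \<gamma> \<alpha> \<kappa> \<sigma> N gbar \<omega>bar \<Gamma> (\<lambda>i. g i x) i
        = a * (g i x - gbar) + c * (m - gbar) + d"
      using assms(3,5)
      by (cases info) (simp_all only: equilibrium_consumption.simps information.case assms(6)
        assms(4)[symmetric] m_def[symmetric], simp_all add: algebra_simps del: coeff_a.simps)
    ultimately show ?thesis by simp
  qed
qed

section \<open>Limits of the equilibrium coefficients\<close>

lemma tendsto_over_N_times_N_minus_1: "(\<lambda>N. x / real N * (real N - 1)) \<longlonglongrightarrow> x"
proof -
  have "(\<lambda>N. x - x / real N) \<longlonglongrightarrow> x - 0"
    by (intro tendsto_intros lim_const_over_n)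
  \<comment> \<open>Only eventual equality holds: at \<open>N = 0\<close> division yields 0, so the
    left side is \<open>x\<close> and the right side is 0.\<close>
  moreover have "\<forall>\<^sub>F N in sequentially. x - x / real N = x / real N * (real N - 1)"
    using eventually_gt_at_top[of 0] by eventually_elim (simp add: field_simps)
  ultimately show ?thesis
    by (simp add: tendsto_cong)
qed

lemma lam_tendsto: "(\<lambda>N. lam \<gamma> \<kappa> N \<Gamma>) \<longlonglongrightarrow> 0"
  by (cases \<Gamma>) (auto intro: lim_const_over_n)

lemma mu_tendsto: "(\<lambda>N. mu \<gamma> N \<Gamma>) \<longlonglongrightarrow> 0"
  by (cases \<Gamma>) (auto intro: lim_const_over_n)

lemma rho_tendsto:
  assumes "\<alpha> > 0"
  shows "(\<lambda>N. rho \<gamma> \<alpha> \<kappa> N \<Gamma>) \<longlonglongrightarrow> inverse (2 * \<alpha>)"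
proof -
  have "(\<lambda>N. tau \<gamma> \<kappa> N \<Gamma>) \<longlonglongrightarrow> 0"
    by (cases \<Gamma>) (auto intro: lim_const_over_n)
  then have "(\<lambda>N. inverse (2 * (tau \<gamma> \<kappa> N \<Gamma> + \<alpha>))) \<longlonglongrightarrow> inverse (2 * (0 + \<alpha>))"
    using assms by (intro tendsto_intros) auto
  then show ?thesis by (simp add: rho_def)
qed

text \<open>The limit of \<open>lam \<gamma> \<kappa> N \<Gamma> * (real N - 1)\<close>: the effect
  of a single other consumer vanishes, that of all others together does not.\<close>

fun lam_scaled :: "real \<Rightarrow> real \<Rightarrow> behavior \<Rightarrow> real" where
  "lam_scaled \<gamma> \<kappa> Selfish = \<gamma>"
| "lam_scaled \<gamma> \<kappa> Altruistic = 2 * \<gamma>"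
| "lam_scaled \<gamma> \<kappa> Welfare_Maximizing = 2 * \<kappa>"

text \<open>The factor \<open>t\<close> serves two denominators: \<open>t = 1\<close> gives that of
  \<open>coeff_b\<close>, and \<open>t = \<sigma>\<close> that of \<open>coeff_a\<close> under
  private information.\<close>

lemma feedback_tendsto:
  assumes "\<alpha> > 0"
  shows "(\<lambda>N. 1 + lam \<gamma> \<kappa> N \<Gamma> * rho \<gamma> \<alpha> \<kappa> N \<Gamma> * t * (real N - 1))
    \<longlonglongrightarrow> 1 + lam_scaled \<gamma> \<kappa> \<Gamma> * inverse (2 * \<alpha>) * t"
proof -
  have "(\<lambda>N. lam \<gamma> \<kappa> N \<Gamma> * (real N - 1)) \<longlonglongrightarrow> lam_scaled \<gamma> \<kappa> \<Gamma>"
    by (cases \<Gamma>) (simp_all only: lam.simps lam_scaled.simps tendsto_over_N_times_N_minus_1)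
  then have "(\<lambda>N. 1 + lam \<gamma> \<kappa> N \<Gamma> * (real N - 1) * rho \<gamma> \<alpha> \<kappa> N \<Gamma> * t)
    \<longlonglongrightarrow> 1 + lam_scaled \<gamma> \<kappa> \<Gamma> * inverse (2 * \<alpha>) * t"
    by (intro tendsto_intros rho_tendsto assms)
  then show ?thesis by (simp add: mult_ac)
qed

text \<open>The three approximations share the form \<open>inverse (lam_scaled \<gamma> \<kappa>
  \<Gamma> + 2 * \<alpha>)\<close>. Positivity of \<open>lam_scaled\<close> keeps the limiting
  denominator away from 0.\<close>

lemma coeff_b_tendsto:
  assumes "\<gamma> > 0" "\<alpha> > 0" "\<kappa> > 0"
  shows "(\<lambda>N. coeff_b \<gamma> \<alpha> \<kappa> N \<Gamma>) \<longlonglongrightarrow> large_b \<gamma> \<alpha> \<kappa> \<Gamma>"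
proof -
  have pos: "lam_scaled \<gamma> \<kappa> \<Gamma> > 0" using assms by (cases \<Gamma>) auto
  then have "1 + lam_scaled \<gamma> \<kappa> \<Gamma> * inverse (2 * \<alpha>) > 0"
    using assms by (intro add_pos_pos mult_pos_pos) auto
  then have "(\<lambda>N. coeff_b \<gamma> \<alpha> \<kappa> N \<Gamma>)
    \<longlonglongrightarrow> inverse (2 * \<alpha>) * inverse (1 + lam_scaled \<gamma> \<kappa> \<Gamma> * inverse (2 * \<alpha>) * 1)"
    unfolding coeff_b_def
    using feedback_tendsto[OF \<open>\<alpha> > 0\<close>, of \<gamma> \<kappa> \<Gamma> 1, unfolded mult_1_right] assms
    by (intro tendsto_mult tendsto_inverse rho_tendsto) auto
  also have "inverse (2 * \<alpha>) * inverse (1 + lam_scaled \<gamma> \<kappa> \<Gamma> * inverse (2 * \<alpha>) * 1)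
      = inverse (lam_scaled \<gamma> \<kappa> \<Gamma> + 2 * \<alpha>)"
    using pos assms by (simp add: field_simps)
  also have "\<dots> = large_b \<gamma> \<alpha> \<kappa> \<Gamma>"
    by (cases \<Gamma>) (simp_all add: algebra_simps)
  finally show ?thesis .
qed

text \<open>Existence of a limit suffices, as \<open>a\<close> enters only the variance term, which
  is later divided by \<open>gbar\<^sup>2\<close>. The denominator tends to a positive number under
  private information and to 1 under complete information.\<close>

lemma coeff_a_convergent:
  assumes "\<gamma> > 0" "\<alpha> > 0" "\<kappa> > 0" "\<sigma> \<ge> 0"
  shows "convergent (\<lambda>N. coeff_a info \<gamma> \<alpha> \<kappa> \<sigma> N \<Gamma>)"
proof (cases info)
  case Private
  have pos: "lam_scaled \<gamma> \<kappa> \<Gamma> > 0" using assms by (cases \<Gamma>) auto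
  then have "1 + lam_scaled \<gamma> \<kappa> \<Gamma> * inverse (2 * \<alpha>) * \<sigma> > 0"
    using assms by (intro add_pos_nonneg mult_nonneg_nonneg) auto
  then have "(\<lambda>N. coeff_a Private \<gamma> \<alpha> \<kappa> \<sigma> N \<Gamma>)
    \<longlonglongrightarrow> inverse (2 * \<alpha>) * inverse (1 + lam_scaled \<gamma> \<kappa> \<Gamma> * inverse (2 * \<alpha>) * \<sigma>)"
    unfolding coeff_a.simps
    by (intro tendsto_mult tendsto_inverse rho_tendsto feedback_tendsto assms) auto
  with Private show ?thesis by (auto simp: convergent_def)
next
  case Complete
  have "(\<lambda>N. coeff_a Complete \<gamma> \<alpha> \<kappa> \<sigma> N \<Gamma>)
    \<longlonglongrightarrow> inverse (2 * \<alpha>) * inverse (1 - 0 * inverse (2 * \<alpha>))"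
    unfolding coeff_a.simps
    by (intro tendsto_intros rho_tendsto lam_tendsto assms) auto
  with Complete show ?thesis by (auto simp: convergent_def)
qed

section \<open>Leading term of the expected welfare\<close>

text \<open>After division by \<open>real N * gbar\<^sup>2\<close> the variance term is a convergent
  sequence over \<open>gbar\<^sup>2\<close> and vanishes however \<open>N\<close> and
  \<open>gbar\<close> grow jointly. The correction by \<open>\<omega>bar\<close> vanishes as well,
  and \<open>b\<close> tends to \<open>large_b\<close>.\<close>

lemma expected_welfare_tendsto:
  assumes "\<gamma> > 0" "\<alpha> > 0" "\<kappa> > 0" "\<sigma> \<ge> 0"
    and model: "\<And>N gbar. N \<ge> 1 \<Longrightarrow> gbar > 0 \<Longrightarrow>
      consumer_model (M N gbar) (g N gbar) (\<omega> N gbar) N gbar \<omega>bar \<sigma>"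
  shows "((\<lambda>(N, gbar). expected_welfare (M N gbar) (g N gbar) (\<omega> N gbar)
      info \<gamma> \<alpha> \<kappa> \<sigma> N gbar \<omega>bar \<Gamma> / (real N * gbar\<^sup>2))
    \<longlongrightarrow> leading_welfare \<gamma> \<alpha> \<kappa> \<Gamma>) (at_top \<times>\<^sub>F at_top)"
proof -
  let ?F = "at_top \<times>\<^sub>F at_top :: (nat \<times> real) filter"
  define a where "a N = coeff_a info \<gamma> \<alpha> \<kappa> \<sigma> N \<Gamma>" for N
  define b where "b N = coeff_b \<gamma> \<alpha> \<kappa> N \<Gamma>" for N
  define c where "c N = (case info of Private \<Rightarrow> 0 | Complete \<Rightarrow> b N - a N)" for N
  define V where "V N = a N - \<alpha> * (a N)\<^sup>2
    + (c N - \<alpha> * (c N)\<^sup>2 - 2 * \<alpha> * a N * c N - \<kappa> * (a N + c N)\<^sup>2) * (\<sigma> + (1 - \<sigma>) / real N)" for N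
  define B where "B = large_b \<gamma> \<alpha> \<kappa> \<Gamma>"
  have b: "b \<longlonglongrightarrow> B"
    using coeff_b_tendsto[of \<gamma> \<alpha> \<kappa> \<Gamma>] assms unfolding b_def[abs_def] B_def by simp
  obtain a' where a: "a \<longlonglongrightarrow> a'"
    using coeff_a_convergent[of \<gamma> \<alpha> \<kappa> \<sigma> info \<Gamma>] assms unfolding a_def[abs_def] convergent_def by auto
  obtain c' where c: "c \<longlonglongrightarrow> c'"
  proof (cases info)
    case Private
    then show ?thesis by (intro that[of 0]) (simp add: c_def[abs_def])
  next
    case Complete
    then show ?thesis
      using tendsto_diff[OF b a] by (intro that[of "B - a'"]) (simp add: c_def[abs_def])
  qed
  obtain V' where V: "V \<longlonglongrightarrow> V'"
  proof -
    \<comment> \<open>\<open>V\<close> is polynomial in convergent sequences; its limit is found by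
      unification, as its value is later multiplied by 0.\<close>
    have "\<exists>V'. V \<longlonglongrightarrow> V'"
      unfolding V_def[abs_def] by (rule exI, (rule a c lim_const_over_n tendsto_intros)+)
    then show ?thesis using that by blast
  qed
  \<comment> \<open>Lifts a limit in \<open>N\<close> alone to the product filter.\<close>
  note fst_lim = filterlim_compose[OF _ filterlim_fst]
  have inv: "((\<lambda>p. inverse (snd p)) \<longlongrightarrow> 0) ?F"
    by (rule filterlim_compose[OF tendsto_inverse_0_at_top[OF filterlim_ident] filterlim_snd])
  have lim: "((\<lambda>p. V (fst p) * (inverse (snd p))\<^sup>2
      + b (fst p) * (1 - \<omega>bar * mu \<gamma> (fst p) \<Gamma> * inverse (snd p))
      - (\<alpha> + \<kappa>) * (b (fst p) * (1 - \<omega>bar * mu \<gamma> (fst p) \<Gamma> * inverse (snd p)))\<^sup>2)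
    \<longlongrightarrow> V' * 0\<^sup>2 + B * (1 - \<omega>bar * 0 * 0) - (\<alpha> + \<kappa>) * (B * (1 - \<omega>bar * 0 * 0))\<^sup>2) ?F"
    by (intro tendsto_intros inv fst_lim[OF V] fst_lim[OF b] fst_lim[OF mu_tendsto])
  \<comment> \<open>The model is assumed only for these pairs, so the exact formula is available
    eventually.\<close>
  have "\<forall>\<^sub>F p in ?F. fst p \<ge> 1 \<and> snd p > 0"
    by (intro eventually_conj eventually_compose_filterlim[OF eventually_ge_at_top filterlim_fst]
        eventually_compose_filterlim[OF eventually_gt_at_top filterlim_snd])
  then have "\<forall>\<^sub>F p in ?F. V (fst p) * (inverse (snd p))\<^sup>2
      + b (fst p) * (1 - \<omega>bar * mu \<gamma> (fst p) \<Gamma> * inverse (snd p))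
      - (\<alpha> + \<kappa>) * (b (fst p) * (1 - \<omega>bar * mu \<gamma> (fst p) \<Gamma> * inverse (snd p)))\<^sup>2
    = (case p of (N, gbar) \<Rightarrow> expected_welfare (M N gbar) (g N gbar) (\<omega> N gbar)
      info \<gamma> \<alpha> \<kappa> \<sigma> N gbar \<omega>bar \<Gamma> / (real N * gbar\<^sup>2))"
  proof eventually_elim
    case (elim p)
    obtain N gbar where p: "p = (N, gbar)" by fastforce
    with elim have N: "N \<ge> 1" "gbar > 0" by auto
    \<comment> \<open>Relative correction by \<open>\<omega>bar\<close>; factoring
      \<open>gbar\<close> out of the constant part lets \<open>gbar\<^sup>2\<close> be pulled out of
      the whole expression.\<close>
    define h where "h = 1 - \<omega>bar * mu \<gamma> N \<Gamma> * inverse gbar"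
    have "expected_welfare (M N gbar) (g N gbar) (\<omega> N gbar) info \<gamma> \<alpha> \<kappa> \<sigma> N gbar \<omega>bar \<Gamma>
      = real N * (V N + gbar * (b N * (gbar - \<omega>bar * mu \<gamma> N \<Gamma>))
          - (\<alpha> + \<kappa>) * (b N * (gbar - \<omega>bar * mu \<gamma> N \<Gamma>))\<^sup>2)"
      unfolding V_def by (rule expected_welfare_eq[OF model[OF N] N(1) a_def b_def c_def refl])
    also have "gbar - \<omega>bar * mu \<gamma> N \<Gamma> = gbar * h"
      using N by (simp add: h_def field_simps)
    also have "V N + gbar * (b N * (gbar * h)) - (\<alpha> + \<kappa>) * (b N * (gbar * h))\<^sup>2
      = gbar\<^sup>2 * (V N * (inverse gbar)\<^sup>2 + b N * h - (\<alpha> + \<kappa>) * (b N * h)\<^sup>2)"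
    proof -
      have "gbar\<^sup>2 * (V N * (inverse gbar)\<^sup>2) = V N"
        using N by (simp add: power_inverse)
      then show ?thesis
        unfolding distrib_left right_diff_distrib by (simp add: power2_eq_square)
    qed
    finally show ?case
      using N unfolding p by (simp add: h_def)
  qed
  from Lim_transform_eventually[OF lim this] show ?thesis
    by (simp add: leading_welfare_def B_def algebra_simps)
qed

section \<open>Closed forms and comparison of the leading coefficients\<close>

text \<open>With \<open>u = \<kappa> + \<alpha>\<close>, the value \<open>1 / (2 * u)\<close> of
  \<open>large_b\<close> maximizes \<open>x - u * x\<^sup>2\<close>, and the maximum is
  \<open>1 / (4 * u)\<close>.\<close>

lemma leading_welfare_Welfare_Maximizing:
  assumes "\<alpha> > 0" "\<kappa> > 0"
  shows "leading_welfare \<gamma> \<alpha> \<kappa> Welfare_Maximizing = 1 / (4 * (\<kappa> + \<alpha>))"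
proof -
  define u where "u = \<kappa> + \<alpha>"
  have "u \<noteq> 0" using assms by (simp add: u_def)
  then show ?thesis
    unfolding leading_welfare_def large_b.simps u_def[symmetric]
    by (simp add: field_simps power2_eq_square)
qed

lemma leading_welfare_ratio_Selfish:
  assumes "\<gamma> > 0" "\<alpha> > 0" "\<kappa> > 0"
  shows "leading_welfare \<gamma> \<alpha> \<kappa> Selfish / leading_welfare \<gamma> \<alpha> \<kappa> Welfare_Maximizing =
    (4 * \<alpha>\<^sup>2 + 4 * \<alpha> * \<gamma> + 4 * \<kappa> * (\<gamma> - \<kappa>)) / (4 * \<alpha>\<^sup>2 + 4 * \<alpha> * \<gamma> + \<gamma>\<^sup>2)"
proof -
  \<comment> \<open>Inverses of the approximate \<open>b\<close>, up to a factor 2 for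
    \<open>v\<close>; in these variables the ratio is
    \<open>4 * v * (u - v) / u\<^sup>2\<close>.\<close>
  define u v where "u = \<gamma> + 2 * \<alpha>" and "v = \<kappa> + \<alpha>"
  have "u \<noteq> 0" using assms by (simp add: u_def)
  then have lead_S: "leading_welfare \<gamma> \<alpha> \<kappa> Selfish = (u - v) / u\<^sup>2"
    unfolding leading_welfare_def large_b.simps u_def[symmetric] v_def[symmetric]
    by (simp add: field_simps power2_eq_square)
  have lead_W: "leading_welfare \<gamma> \<alpha> \<kappa> Welfare_Maximizing = 1 / (4 * v)"
    using leading_welfare_Welfare_Maximizing assms by (simp add: v_def)
  have "4 * \<alpha>\<^sup>2 + 4 * \<alpha> * \<gamma> + \<gamma>\<^sup>2 = u\<^sup>2"
    "4 * \<alpha>\<^sup>2 + 4 * \<alpha> * \<gamma> + 4 * \<kappa> * (\<gamma> - \<kappa>) = 4 * v * (u - v)"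
    by (simp_all add: u_def v_def power2_eq_square algebra_simps)
  then show ?thesis
    by (simp add: lead_S lead_W)
qed

lemma leading_welfare_ratio_Altruistic:
  assumes "\<gamma> > 0" "\<alpha> > 0" "\<kappa> > 0"
  shows "leading_welfare \<gamma> \<alpha> \<kappa> Altruistic / leading_welfare \<gamma> \<alpha> \<kappa> Welfare_Maximizing =
    (\<kappa> + \<alpha>) * (2 * \<gamma> + \<alpha> - \<kappa>) / (\<gamma> + \<alpha>)\<^sup>2"
proof -
  \<comment> \<open>In these variables the ratio is
    \<open>v * (2 * u - v) / u\<^sup>2\<close>.\<close>
  define u v where "u = \<gamma> + \<alpha>" and "v = \<kappa> + \<alpha>"
  have "u \<noteq> 0" using assms by (simp add: u_def)
  then have "leading_welfare \<gamma> \<alpha> \<kappa> Altruistic = (2 * u - v) / (4 * u\<^sup>2)"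
    unfolding leading_welfare_def large_b.simps u_def[symmetric] v_def[symmetric]
    by (simp add: field_simps power2_eq_square)
  moreover have "leading_welfare \<gamma> \<alpha> \<kappa> Welfare_Maximizing = 1 / (4 * v)"
    using leading_welfare_Welfare_Maximizing assms by (simp add: v_def)
  moreover have "2 * \<gamma> + \<alpha> - \<kappa> = 2 * u - v"
    by (simp add: u_def v_def)
  ultimately show ?thesis
    by (simp flip: u_def v_def)
qed

text \<open>The denominator exceeds the numerator by the square of
  \<open>\<gamma> - 2 * \<kappa>\<close>.\<close>

lemma selfish_ratio_less_1_iff:
  fixes \<gamma> \<alpha> \<kappa> :: real
  assumes "\<gamma> > 0" "\<alpha> > 0"
  shows "(4 * \<alpha>\<^sup>2 + 4 * \<alpha> * \<gamma> + 4 * \<kappa> * (\<gamma> - \<kappa>)) / (4 * \<alpha>\<^sup>2 + 4 * \<alpha> * \<gamma> + \<gamma>\<^sup>2) < 1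
    \<longleftrightarrow> \<gamma> \<noteq> 2 * \<kappa>"
proof -
  have "4 * \<alpha>\<^sup>2 + 4 * \<alpha> * \<gamma> + \<gamma>\<^sup>2 > 0"
    using assms by (intro add_pos_pos) auto
  moreover have "4 * \<alpha>\<^sup>2 + 4 * \<alpha> * \<gamma> + 4 * \<kappa> * (\<gamma> - \<kappa>)
      = 4 * \<alpha>\<^sup>2 + 4 * \<alpha> * \<gamma> + \<gamma>\<^sup>2 - (\<gamma> - 2 * \<kappa>)\<^sup>2"
    by (simp add: power2_eq_square algebra_simps)
  moreover have "(\<gamma> - 2 * \<kappa>)\<^sup>2 > 0 \<longleftrightarrow> \<gamma> \<noteq> 2 * \<kappa>"
    by simp
  ultimately show ?thesis by (simp add: divide_less_eq)
qed

text \<open>Here the gap between denominator and numerator is the square of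
  \<open>\<gamma> - \<kappa>\<close>.\<close>

lemma altruistic_ratio_less_1_iff:
  fixes \<gamma> \<alpha> \<kappa> :: real
  assumes "\<gamma> > 0" "\<alpha> > 0"
  shows "(\<kappa> + \<alpha>) * (2 * \<gamma> + \<alpha> - \<kappa>) / (\<gamma> + \<alpha>)\<^sup>2 < 1 \<longleftrightarrow> \<gamma> \<noteq> \<kappa>"
proof -
  have "(\<gamma> + \<alpha>)\<^sup>2 > 0"
    using assms by auto
  moreover have "(\<kappa> + \<alpha>) * (2 * \<gamma> + \<alpha> - \<kappa>) = (\<gamma> + \<alpha>)\<^sup>2 - (\<gamma> - \<kappa>)\<^sup>2"
    by (simp add: power2_eq_square algebra_simps)
  moreover have "(\<gamma> - \<kappa>)\<^sup>2 > 0 \<longleftrightarrow> \<gamma> \<noteq> \<kappa>"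
    by simp
  ultimately show ?thesis by (simp add: divide_less_eq)
qed

section \<open>From scaled limits to inequalities and ratios\<close>

text \<open>A number strictly between the two limits eventually separates the scaled functions, and
  the positive scale \<open>r\<close> cancels.\<close>

lemma eventually_less_of_tendsto_scaled:
  fixes f g r :: "'p \<Rightarrow> real"
  assumes "((\<lambda>p. f p / r p) \<longlongrightarrow> x) F" and "((\<lambda>p. g p / r p) \<longlongrightarrow> y) F"
    and "\<forall>\<^sub>F p in F. r p > 0" and "x < y"
  shows "\<forall>\<^sub>F p in F. f p < g p"
proof -
  obtain z where z: "x < z" "z < y" using dense[OF \<open>x < y\<close>] by blast
  have "\<forall>\<^sub>F p in F. f p / r p < z" "\<forall>\<^sub>F p in F. z < g p / r p"
    using order_tendstoD(2)[OF assms(1) z(1)] order_tendstoD(1)[OF assms(2) z(2)] .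
  with assms(3) show ?thesis
  proof eventually_elim
    case (elim p)
    then have "f p / r p < g p / r p" by simp
    with elim show ?case by (simp add: divide_less_cancel)
  qed
qed

lemma tendsto_divide_of_tendsto_scaled:
  fixes f g r :: "'p \<Rightarrow> real"
  assumes "((\<lambda>p. f p / r p) \<longlongrightarrow> x) F" and "((\<lambda>p. g p / r p) \<longlongrightarrow> y) F"
    and "\<forall>\<^sub>F p in F. r p > 0" and "y \<noteq> 0"
  shows "((\<lambda>p. f p / g p) \<longlongrightarrow> x / y) F"
proof -
  have "\<forall>\<^sub>F p in F. f p / r p / (g p / r p) = f p / g p"
    using assms(3) by eventually_elim simp
  from tendsto_cong[OF this] tendsto_divide[OF assms(1,2,4)] show ?thesis
    by blast
qed

text \<open>"For large \<open>N\<close> and \<open>gbar\<close>" is rendered both as a joint limit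
  of the exact expected welfares and as an identity between leading coefficients. The strict
  comparisons hold at both levels; the cases of equality concern the limiting ratio and the leading
  coefficients.\<close>

theorem corollary9:
  fixes \<gamma> \<alpha> \<kappa> \<sigma> \<omega>bar :: real
    and M :: "nat \<Rightarrow> real \<Rightarrow> 'a measure"
    and g :: "nat \<Rightarrow> real \<Rightarrow> nat \<Rightarrow> 'a \<Rightarrow> real"
    and \<omega> :: "nat \<Rightarrow> real \<Rightarrow> 'a \<Rightarrow> real"
    and info :: information
  assumes "\<gamma> > 0" and "\<alpha> > 0" and "\<kappa> > 0" and "\<sigma> \<in> {0..1}"
    and "\<And>N gbar. N \<ge> 1 \<Longrightarrow> gbar > 0 \<Longrightarrow>
           consumer_model (M N gbar) (g N gbar) (\<omega> N gbar) N gbar \<omega>bar \<sigma>"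
  shows "let EW = (\<lambda>\<Gamma> (N, gbar). expected_welfare (M N gbar) (g N gbar) (\<omega> N gbar)
                     info \<gamma> \<alpha> \<kappa> \<sigma> N gbar \<omega>bar \<Gamma>);
             large = (at_top \<times>\<^sub>F at_top :: (nat \<times> real) filter);
             lead = leading_welfare \<gamma> \<alpha> \<kappa>;
             ratio_S = (4 * \<alpha>\<^sup>2 + 4 * \<alpha> * \<gamma> + 4 * \<kappa> * (\<gamma> - \<kappa>)) / (4 * \<alpha>\<^sup>2 + 4 * \<alpha> * \<gamma> + \<gamma>\<^sup>2);
             ratio_U = (\<kappa> + \<alpha>) * (2 * \<gamma> + \<alpha> - \<kappa>) / (\<gamma> + \<alpha>)\<^sup>2
         in (\<forall>\<Gamma>. ((\<lambda>(N, gbar). EW \<Gamma> (N, gbar) / (real N * gbar\<^sup>2)) \<longlongrightarrow> lead \<Gamma>) large)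
          \<and> (\<forall>\<^sub>F p in large. EW Welfare_Maximizing p > 0)
          \<and> ((\<lambda>p. EW Selfish p / EW Welfare_Maximizing p) \<longlongrightarrow> ratio_S) large
          \<and> lead Selfish / lead Welfare_Maximizing = ratio_S
          \<and> (\<gamma> \<noteq> 2 * \<kappa> \<longrightarrow>
               ratio_S < 1 \<and> lead Selfish < lead Welfare_Maximizing
               \<and> (\<forall>\<^sub>F p in large. EW Selfish p < EW Welfare_Maximizing p))
          \<and> (\<gamma> = 2 * \<kappa> \<longrightarrow> ratio_S = 1 \<and> lead Selfish = lead Welfare_Maximizing)
          \<and> ((\<lambda>p. EW Altruistic p / EW Welfare_Maximizing p) \<longlongrightarrow> ratio_U) large
          \<and> lead Altruistic / lead Welfare_Maximizing = ratio_U
          \<and> (\<gamma> \<noteq> \<kappa> \<longrightarrow>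
               ratio_U < 1 \<and> lead Altruistic < lead Welfare_Maximizing
               \<and> (\<forall>\<^sub>F p in large. EW Altruistic p < EW Welfare_Maximizing p))
          \<and> (\<gamma> = \<kappa> \<longrightarrow> ratio_U = 1 \<and> lead Altruistic = lead Welfare_Maximizing)"
proof -
  define EW where "EW = (\<lambda>\<Gamma> (N, gbar). expected_welfare (M N gbar) (g N gbar) (\<omega> N gbar)
                     info \<gamma> \<alpha> \<kappa> \<sigma> N gbar \<omega>bar \<Gamma>)"
  define large where "large = (at_top \<times>\<^sub>F at_top :: (nat \<times> real) filter)"
  define lead where "lead = leading_welfare \<gamma> \<alpha> \<kappa>"
  define ratio_S where
    "ratio_S = (4 * \<alpha>\<^sup>2 + 4 * \<alpha> * \<gamma> + 4 * \<kappa> * (\<gamma> - \<kappa>)) / (4 * \<alpha>\<^sup>2 + 4 * \<alpha> * \<gamma> + \<gamma>\<^sup>2)"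
  define ratio_U where "ratio_U = (\<kappa> + \<alpha>) * (2 * \<gamma> + \<alpha> - \<kappa>) / (\<gamma> + \<alpha>)\<^sup>2"
  define r :: "nat \<times> real \<Rightarrow> real" where "r = (\<lambda>(N, gbar). real N * gbar\<^sup>2)"
  have lim': "((\<lambda>(N, gbar). EW \<Gamma> (N, gbar) / (real N * gbar\<^sup>2)) \<longlongrightarrow> lead \<Gamma>) large" for \<Gamma>
    using expected_welfare_tendsto[of \<gamma> \<alpha> \<kappa> \<sigma> M g \<omega> \<omega>bar info \<Gamma>] assms
    by (simp add: EW_def large_def lead_def)
  then have lim: "((\<lambda>p. EW \<Gamma> p / r p) \<longlongrightarrow> lead \<Gamma>) large" for \<Gamma>
    by (simp add: r_def case_prod_unfold)
  have r: "\<forall>\<^sub>F p in large. r p > 0"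
    unfolding large_def eventually_prod_filter r_def
    using eventually_gt_at_top[of "0::nat"] eventually_gt_at_top[of "0::real"] by fastforce
  have pos: "lead Welfare_Maximizing > 0"
    using leading_welfare_Welfare_Maximizing assms by (simp add: lead_def)
  \<comment> \<open>Comparison with the zero function, whose scaled limit is 0.\<close>
  have EW_pos: "\<forall>\<^sub>F p in large. EW Welfare_Maximizing p > 0"
    by (rule eventually_less_of_tendsto_scaled[OF _ lim r pos]) simp
  have ratios: "lead Selfish / lead Welfare_Maximizing = ratio_S"
    "lead Altruistic / lead Welfare_Maximizing = ratio_U"
    using leading_welfare_ratio_Selfish leading_welfare_ratio_Altruistic assms
    by (simp_all add: lead_def ratio_S_def ratio_U_def)
  have lim_ratio: "((\<lambda>p. EW \<Gamma> p / EW Welfare_Maximizing p)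
      \<longlongrightarrow> lead \<Gamma> / lead Welfare_Maximizing) large" for \<Gamma>
    by (rule tendsto_divide_of_tendsto_scaled[OF lim lim r]) (use pos in simp)
  have lt: "lead \<Gamma> < lead Welfare_Maximizing
      \<and> (\<forall>\<^sub>F p in large. EW \<Gamma> p < EW Welfare_Maximizing p)"
    if "lead \<Gamma> / lead Welfare_Maximizing < 1" for \<Gamma>
    using that pos eventually_less_of_tendsto_scaled[OF lim lim r] by (simp add: divide_less_eq)
  have S1: "ratio_S < 1 \<longleftrightarrow> \<gamma> \<noteq> 2 * \<kappa>" and U1: "ratio_U < 1 \<longleftrightarrow> \<gamma> \<noteq> \<kappa>"
    unfolding ratio_S_def ratio_U_def
    using selfish_ratio_less_1_iff altruistic_ratio_less_1_iff assms by blast+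
  have S2: "ratio_S = 1" if "\<gamma> = 2 * \<kappa>"
  proof -
    have "4 * \<alpha>\<^sup>2 + 4 * \<alpha> * \<gamma> + \<gamma>\<^sup>2 > 0"
      using assms by (intro add_pos_pos) auto
    then show ?thesis
      by (simp add: ratio_S_def that power2_eq_square)
  qed
  have U2: "ratio_U = 1" if "\<gamma> = \<kappa>"
    using assms(1,2) by (simp add: ratio_U_def that[symmetric] power2_eq_square)
  have eq: "lead \<Gamma> = lead Welfare_Maximizing" if "lead \<Gamma> / lead Welfare_Maximizing = 1" for \<Gamma>
    using that pos by (simp add: divide_eq_1_iff)
  show ?thesis
    unfolding Let_def EW_def[symmetric] large_def[symmetric] lead_def[symmetric]
      ratio_S_def[symmetric] ratio_U_def[symmetric]
    using lim' EW_pos ratios lim_ratio[of Selfish] lim_ratio[of Altruistic]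
      lt[of Selfish] lt[of Altruistic] S1 U1 S2 U2 eq[of Selfish] eq[of Altruistic]
    by (intro conjI allI impI) simp_all
qed

end
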